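(* Let $A$ be an $n\times q$ matrix with entries in $\mathbb{N}$, all of whose rows and columns are nonzero, and let $v_1,\ldots,v_q$ be the columns of $A$. Let $w_1,\ldots,w_r$ be the set of all $\alpha\in\mathbb{N}^n$ such that $\alpha\leq v_i$ for some $i$. Let $K$ be a field. Then the system $x\geq 0;\ xA\leq\mathbf{1}$ has the integer rounding property if and only if the subring $K[x^{w_1}t,\ldots,x^{w_r}t]$ of the polynomial ring $K[x_1,\ldots,x_n,t]$ is normal.
   Context: $x^a:=x_1^{a_1}\cdots x_n^{a_n}$ for $a\in\mathbb{N}^n$; $\mathbf{1}$ is the all-ones vector; vector inequalities are componentwise; $\langle\,,\rangle$ is the standard inner product. Normal means integrally closed in its field of fractions. The system $x\geq 0;\ xA\leq\mathbf{1}$ has the integer rounding property if $$\lceil\min\{\langle y,\mathbf{1}\rangle\mid y\in\mathbb{R}^q,\ y\geq 0;\ Ay\geq a\}\rceil=\min\{\langle y,\mathbf{1}\rangle\mid Ay\geq a;\ y\in\mathbb{N}^q\}$$ for each integral vector $a$ for which $\min\{\langle y,\mathbf{1}\rangle\mid y\geq 0;\ Ay\geq a\}$ is finite. *)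

theory Defs
  imports
    Jordan_Normal_Form.Matrix
    "HOL-Library.Poly_Mapping"
    "HOL-Computational_Algebra.Polynomial_Factorial"
begin

definition is_minimum :: "'a::order set \<Rightarrow> 'a \<Rightarrow> bool" where
  "is_minimum S m \<longleftrightarrow> m \<in> S \<and> (\<forall>s\<in>S. m \<le> s)"

text \<open>
  The objective values of the covering program: minimise the sum of the entries of \<open>y\<close> subject to
  \<open>y \<ge> 0\<close> and \<open>Ay \<ge> a\<close>, over the reals or over the integers (where the vectors \<open>y \<ge> 0\<close> are
  exactly the vectors with natural number entries).  The order on vectors is componentwise.
\<close>

definition covering_values :: "'a::linordered_idom mat \<Rightarrow> 'a vec \<Rightarrow> 'a set" where
  "covering_values A a =
     {y \<bullet> vec (dim_col A) (\<lambda>_. 1) | y.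
        y \<in> carrier_vec (dim_col A) \<and> 0\<^sub>v (dim_col A) \<le> y \<and> a \<le> A *\<^sub>v y}"

text \<open>
  The integer rounding property of the system \<open>x \<ge> 0\<close>, \<open>xA \<le> 1\<close>.  The minimum being finite is
  expressed by its being attained at some real value \<open>m\<close>; a linear program that is feasible and
  bounded attains its optimum, so this is the usual meaning.
\<close>

definition integer_rounding_property :: "nat mat \<Rightarrow> bool" where
  "integer_rounding_property A \<longleftrightarrow>
     (\<forall>a :: int vec. a \<in> carrier_vec (dim_row A) \<longrightarrow>
        (\<forall>m. is_minimum (covering_values (map_mat real A) (map_vec real_of_int a)) m \<longrightarrow>
             is_minimum (covering_values (map_mat int A) a) \<lceil>m\<rceil>))"

text \<open>
  Polynomials in countably many variables over \<open>'k\<close>.  The ring \<open>K[x\<^sub>1,\<dots>,x\<^sub>n,t]\<close> is the subring of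
  polynomials in the variables \<open>0,\<dots>,n\<close>, where \<open>x\<^sub>1,\<dots>,x\<^sub>n\<close> are the variables \<open>0,\<dots>,n-1\<close> and
  \<open>t\<close> is the variable \<open>n\<close>.
\<close>

type_synonym 'k mpolynomial = "(nat \<Rightarrow>\<^sub>0 nat) \<Rightarrow>\<^sub>0 'k"

definition mconst :: "'k \<Rightarrow> 'k::comm_ring_1 mpolynomial" where
  "mconst c = Poly_Mapping.single 0 c"

definition mvar :: "nat \<Rightarrow> 'k::comm_ring_1 mpolynomial" where
  "mvar i = Poly_Mapping.single (Poly_Mapping.single i 1) 1"

definition xmonomial :: "nat vec \<Rightarrow> 'k::comm_ring_1 mpolynomial" where
  "xmonomial a = (\<Prod>i<dim_vec a. mvar i ^ (a $ i))"

inductive_set generated_subalgebra :: "'k::comm_ring_1 mpolynomial set \<Rightarrow> 'k mpolynomial set"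
  for G where
  const: "mconst c \<in> generated_subalgebra G"
| gen: "g \<in> G \<Longrightarrow> g \<in> generated_subalgebra G"
| add: "p \<in> generated_subalgebra G \<Longrightarrow> p' \<in> generated_subalgebra G
          \<Longrightarrow> p + p' \<in> generated_subalgebra G"
| mult: "p \<in> generated_subalgebra G \<Longrightarrow> p' \<in> generated_subalgebra G
          \<Longrightarrow> p * p' \<in> generated_subalgebra G"

text \<open>
  For a subring \<open>R\<close> of an integral domain, its field of fractions is realised inside the field of
  fractions of the ambient domain.
\<close>

definition fraction_field_of :: "'a::idom set \<Rightarrow> 'a fract set" where
  "fraction_field_of R = {Fract p s | p s. p \<in> R \<and> s \<in> R \<and> s \<noteq> 0}"

definition integral_over :: "'a::idom set \<Rightarrow> 'a fract \<Rightarrow> bool" where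
  "integral_over R z \<longleftrightarrow>
     (\<exists>f :: 'a fract poly. lead_coeff f = 1 \<and> (\<forall>i. coeff f i \<in> to_fract ` R) \<and> poly f z = 0)"

definition normal_subring :: "'a::idom set \<Rightarrow> bool" where
  "normal_subring R \<longleftrightarrow> (\<forall>z \<in> fraction_field_of R. integral_over R z \<longrightarrow> z \<in> to_fract ` R)"

definition column_lower_set :: "nat mat \<Rightarrow> nat vec set" where
  "column_lower_set A =
     {\<alpha>. \<alpha> \<in> carrier_vec (dim_row A) \<and> (\<exists>i<dim_col A. \<alpha> \<le> col A i)}"

end

theory Submission
  imports
    "HOL-Analysis.Kronecker_Approximation_Theorem"
    "HOL-Analysis.Function_Topology"
    Defs
begin

text \<open>
  The subalgebra is the monoid algebra of the pairs \<open>(a, b)\<close> for which some \<open>y \<in> \<nat>\<^sup>q\<close> with entry sum \<open>b\<close>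
  satisfies \<open>Ay \<ge> a\<close>.  The integer rounding property says that this monoid contains all lattice points
  of the cone of the pairs satisfying the same condition with real \<open>y \<ge> 0\<close>.

  If the ring is normal, a lattice point of the cone has a multiple in the monoid, because a real
  solution can be replaced by a rational one (Dirichlet approximation); so the corresponding monomial
  has a power in the ring and lies in the fraction field, hence lies in the ring.

  Conversely, an integral element \<open>p / s\<close> has \<open>c (p / s)^k\<close> in the ring for all \<open>k\<close> and some \<open>c \<noteq> 0\<close>.
  Comparing leading exponents for a monomial order and letting \<open>k\<close> tend to infinity puts
  the leading exponent of \<open>p / s\<close> into the closed cone, hence into the monoid.  Subtracting the
  leading term and repeating ends after finitely many steps, since the order is a well-order on
  monomials in finitely many variables.  No factoriality of the polynomial ring is needed.
\<close>

unbundle no vec_syntax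

subsection \<open>The covering program\<close>

abbreviation "lookup \<equiv> Poly_Mapping.lookup"
abbreviation "keys \<equiv> Poly_Mapping.keys"

text \<open>Functions on indices instead of vectors let one predicate serve naturals, integers and
  reals. Values outside the dimensions are ignored, so \<open>c\<close> may be an exponent vector
  that also carries the exponent of t.\<close>

definition covers :: "nat mat \<Rightarrow> (nat \<Rightarrow> 'a) \<Rightarrow> (nat \<Rightarrow> 'a::linordered_semidom) \<Rightarrow> bool" where
  "covers A c y \<longleftrightarrow> (\<forall>j<dim_col A. 0 \<le> y j) \<and>
     (\<forall>i<dim_row A. c i \<le> (\<Sum>j<dim_col A. of_nat (A $$ (i, j)) * y j))"

abbreviation total :: "nat mat \<Rightarrow> (nat \<Rightarrow> 'a) \<Rightarrow> 'a::linordered_semidom" where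
  "total A y \<equiv> sum y {..<dim_col A}"

lemma covering_values_eq:
  fixes a :: "'a::linordered_idom vec"
  assumes "a \<in> carrier_vec (dim_row A)"
  shows "covering_values (map_mat of_nat A) a = {total A y | y. covers A (($) a) y}"
proof (intro equalityI subsetI)
  fix s assume "s \<in> covering_values (map_mat of_nat A) a"
  then obtain y where y: "y \<in> carrier_vec (dim_col A)" "0\<^sub>v (dim_col A) \<le> y"
      "a \<le> map_mat of_nat A *\<^sub>v y" "s = y \<bullet> vec (dim_col A) (\<lambda>_. 1)"
    by (auto simp: covering_values_def)
  then have "covers A (($) a) (($) y)"
    by (auto simp: covers_def less_eq_vec_def scalar_prod_def atLeast0LessThan)
  moreover have "s = total A (($) y)"
    using y by (auto simp: scalar_prod_def atLeast0LessThan)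
  ultimately show "s \<in> {total A y | y. covers A (($) a) y}" by blast
next
  fix s assume "s \<in> {total A y | y. covers A (($) a) y}"
  then obtain y where y: "covers A (($) a) y" "s = total A y" by blast
  show "s \<in> covering_values (map_mat of_nat A) a"
    unfolding covering_values_def
    by (rule CollectI, rule exI[of _ "vec (dim_col A) y"])
       (use y assms in \<open>auto simp: covers_def less_eq_vec_def scalar_prod_def atLeast0LessThan\<close>)
qed

section \<open>Elementary operations on covers\<close>

lemma covers_add: "covers A c y \<Longrightarrow> covers A d z \<Longrightarrow> covers A (\<lambda>i. c i + d i) (\<lambda>j. y j + z j)"
  by (auto simp: covers_def distrib_left sum.distrib intro!: add_mono)

text \<open>The entries of \<open>A\<close> are nonnegative, so raising the multiplicities never
  lowers the sums.\<close>

lemma covers_mono: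
  fixes y z :: "nat \<Rightarrow> 'a::linordered_semidom"
  assumes "covers A c y" "\<And>j. j < dim_col A \<Longrightarrow> y j \<le> z j" "\<And>i. i < dim_row A \<Longrightarrow> d i \<le> c i"
  shows "covers A d z"
proof -
  have "d i \<le> (\<Sum>j<dim_col A. of_nat (A $$ (i, j)) * z j)" if "i < dim_row A" for i
  proof -
    have "d i \<le> (\<Sum>j<dim_col A. of_nat (A $$ (i, j)) * y j)"
      using assms that unfolding covers_def by (meson order.trans)
    also have "\<dots> \<le> (\<Sum>j<dim_col A. of_nat (A $$ (i, j)) * z j)"
      by (intro sum_mono mult_left_mono assms) auto
    finally show ?thesis .
  qed
  then show ?thesis
    using assms unfolding covers_def by (meson order.trans)
qed

text \<open>The monoid below asks for the exact total \<open>b\<close>; extra copies of column 0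
  reach it. Without columns every total is 0, whence the last hypothesis.\<close>

lemma covers_pad:
  fixes z :: "nat \<Rightarrow> nat"
  assumes "covers A c z" "total A z \<le> b" "dim_col A = 0 \<Longrightarrow> b = 0"
  obtains z' where "covers A c z'" "total A z' = b"
proof (cases "dim_col A = 0")
  case True
  then show ?thesis using that[of z] assms by simp
next
  case False
  define z' where "z' = (\<lambda>j. z j + (if j = 0 then b - total A z else 0))"
  have "covers A c z'"
    using assms(1) by (rule covers_mono) (auto simp: z'_def)
  moreover have "total A z' = b"
    using False assms(2) by (simp add: z'_def sum.distrib)
  ultimately show ?thesis using that by blast
qed

text \<open>Dirichlet approximation moves a real point of a polyhedron given by integral inequalities
  close to a rational point with denominator \<open>N\<close>; after scaling by \<open>N\<close> every inequality is violated
  by less than 1, hence not at all.\<close>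

lemma covers_rational:
  fixes y :: "nat \<Rightarrow> real" and c :: "nat \<Rightarrow> nat"
  assumes y: "covers A (\<lambda>i. real (c i)) y" and b: "total A y \<le> real b"
  obtains N z where "N > 0" "covers A (\<lambda>i. N * c i) z" "total A z \<le> N * b"
proof -
  \<comment> \<open>\<open>T\<close> exceeds every row sum and the number of columns, so coordinate
    errors below \<open>1 / T\<close> add up to less than 1 in each inequality.\<close>
  define T where "T = (\<Sum>i<dim_row A. \<Sum>j<dim_col A. A $$ (i, j)) + dim_col A + 1"
  have T: "T > 0" by (simp add: T_def)
  then obtain Q p where Q: "0 < Q"
    and p: "\<And>j. j < dim_col A \<Longrightarrow> \<bar>of_int Q * y j - of_int (p j)\<bar> < 1 / T"
    using Dirichlet_approx_simult[of T "dim_col A" y] by metis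
  have T1: "1 / real T \<le> 1" using T by simp
  \<comment> \<open>An integer at distance less than 1 from a nonnegative number is itself
    nonnegative.\<close>
  have p0: "p j \<ge> 0" if "j < dim_col A" for j
  proof -
    have "of_int Q * y j \<ge> 0" using y Q that by (simp add: covers_def)
    with p[OF that] T1 have "real_of_int (p j) > -1" by linarith
    then show ?thesis by linarith
  qed
  define z where "z j = nat (p j)" for j
  have z: "real (z j) = of_int (p j)" if "j < dim_col A" for j
    using p0[OF that] by (simp add: z_def)
  define N where "N = nat Q"
  have N: "N > 0" "of_int Q = real N" using Q by (auto simp: N_def)
  have "N * c i \<le> (\<Sum>j<dim_col A. A $$ (i, j) * z j)" if i: "i < dim_row A" for i
  proof -
    have "(\<Sum>j<dim_col A. A $$ (i, j)) \<le> (\<Sum>i<dim_row A. \<Sum>j<dim_col A. A $$ (i, j))"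
      using i by (intro member_le_sum) auto
    then have "(\<Sum>j<dim_col A. A $$ (i, j)) < T" unfolding T_def by linarith
    then have lt: "(\<Sum>j<dim_col A. real (A $$ (i, j))) * (1 / T) < 1"
      using T by (simp flip: of_nat_sum)
    have "real N * c i \<le> real N * (\<Sum>j<dim_col A. real (A $$ (i, j)) * y j)"
      using y i by (intro mult_left_mono) (auto simp: covers_def)
    also have "\<dots> = (\<Sum>j<dim_col A. real (A $$ (i, j)) * (real N * y j))"
      by (simp add: sum_distrib_left algebra_simps)
    also have "\<dots> \<le> (\<Sum>j<dim_col A. real (A $$ (i, j)) * (real (z j) + 1 / T))"
    proof (intro sum_mono mult_left_mono)
      fix j assume "j \<in> {..<dim_col A}"
      with p[of j] z[of j] N show "real N * y j \<le> real (z j) + 1 / T" by simp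
    qed auto
    also have "\<dots> = (\<Sum>j<dim_col A. real (A $$ (i, j)) * z j)
        + (\<Sum>j<dim_col A. real (A $$ (i, j))) * (1 / T)"
      by (simp add: distrib_left sum.distrib sum_divide_distrib)
    finally have "real N * c i < (\<Sum>j<dim_col A. real (A $$ (i, j)) * z j) + 1"
      using lt by linarith
    then have "real (N * c i) < real ((\<Sum>j<dim_col A. A $$ (i, j) * z j) + 1)" by simp
    then show ?thesis unfolding of_nat_less_iff by linarith
  qed
  moreover have "total A z \<le> N * b"
  proof -
    have "real (dim_col A) * (1 / T) < 1"
    proof -
      have "dim_col A < T" by (simp add: T_def)
      then show ?thesis using T by simp
    qed
    moreover have "(\<Sum>j<dim_col A. real (z j)) \<le> (\<Sum>j<dim_col A. real N * y j + 1 / T)"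
    proof (rule sum_mono)
      fix j assume "j \<in> {..<dim_col A}"
      with p[of j] z[of j] N show "real (z j) \<le> real N * y j + 1 / T" by simp
    qed
    moreover have "\<dots> = real N * total A y + real (dim_col A) * (1 / T)"
      by (simp add: sum.distrib sum_distrib_left)
    moreover have "real N * total A y \<le> real N * b" by (intro mult_left_mono b) auto
    ultimately have "real (total A z) < real (N * b + 1)" by simp
    then show ?thesis unfolding of_nat_less_iff by linarith
  qed
  ultimately show ?thesis using that[of N z] N by (simp add: covers_def)
qed

text \<open>By compactness: covers with total at most that of \<open>y0\<close> have all their
  relevant coordinates between 0 and \<open>total A y0\<close>.\<close>

lemma covers_minimum:
  fixes y0 :: "nat \<Rightarrow> real"
  assumes y0: "covers A c y0"
  obtains m where "is_minimum {total A y | y. covers A c y} m"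
proof -
  \<comment> \<open>Coordinates outside the matrix are unconstrained; setting them to 0 puts a cover
    into the product of intervals without changing its total.\<close>
  define r where "r y = (\<lambda>j. if j < dim_col A then y j else 0 :: real)" for y
  have r: "covers A c (r y) \<longleftrightarrow> covers A c y" "total A (r y) = total A y" for y
    by (auto simp: covers_def r_def)
  define K where "K = {y. covers A c y} \<inter> PiE UNIV (\<lambda>_. {0..total A y0})"
  have rK: "r y \<in> K" if y: "covers A c y" "total A y \<le> total A y0" for y
  proof -
    have "y j \<le> total A y0" if "j < dim_col A" for j
    proof -
      have "y j \<le> total A y"
        using that y by (intro member_le_sum) (auto simp: covers_def)
      with y show ?thesis by simp
    qed
    moreover have "0 \<le> total A y0" using y0 by (intro sum_nonneg) (auto simp: covers_def)
    ultimately show ?thesis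
      using y r(1)[of y] by (auto simp: K_def r_def covers_def)
  qed
  have "closed {y. covers A c y}"
  proof -
    have "{y. covers A c y} = (\<Inter>j<dim_col A. {y. 0 \<le> y j}) \<inter>
       (\<Inter>i<dim_row A. {y. c i \<le> (\<Sum>j<dim_col A. of_nat (A $$ (i, j)) * y j)})"
      by (auto simp: covers_def)
    then show ?thesis
      by (auto intro!: closed_Int closed_INT closed_Collect_le continuous_intros
          continuous_on_product_coordinates)
  qed
  \<comment> \<open>Tychonoff's theorem for the product topology on functions.\<close>
  moreover have "compact (PiE UNIV (\<lambda>_::nat. {0..total A y0}))"
    using compactin_PiE[of "\<lambda>_::nat. euclideanreal" UNIV "\<lambda>_. {0..total A y0}"]
    by (simp add: euclidean_product_topology)
  ultimately have "compact K" unfolding K_def by (rule closed_Int_compact)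
  moreover have "r y0 \<in> K" using y0 by (intro rK) auto
  moreover have "continuous_on K (\<lambda>y. total A y)"
    by (intro continuous_on_sum continuous_on_subset[OF continuous_on_product_coordinates]) auto
  ultimately obtain y where y: "y \<in> K" "\<And>y'. y' \<in> K \<Longrightarrow> total A y \<le> total A y'"
    using continuous_attains_inf[of K "\<lambda>y. total A y"] by blast
  have "total A y \<le> total A y'" if y': "covers A c y'" for y'
  proof (cases "total A y' \<le> total A y0")
    case True
    then show ?thesis using y(2)[OF rK[OF y']] by (simp add: r)
  next
    case False
    then show ?thesis using y(2)[OF \<open>r y0 \<in> K\<close>] by (simp add: r)
  qed
  then show ?thesis
    using that[of "total A y"] y(1) by (auto simp: is_minimum_def K_def)
qed

subsection \<open>The monoid of covered exponents\<close>

text \<open>The exponent vectors of the monomials in \<open>K[x^w\<^sub>1 t, \<dots>, x^w\<^sub>r t]\<close>: the columns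
  chosen by \<open>y\<close> cover the exponent of \<open>x\<close>, and their number is the exponent of \<open>t\<close>.\<close>

definition cover_monoid :: "nat mat \<Rightarrow> (nat \<Rightarrow>\<^sub>0 nat) set" where
  "cover_monoid A = {u. keys u \<subseteq> {..dim_row A} \<and>
     (\<exists>y. covers A (lookup u) y \<and> total A y = lookup u (dim_row A))}"

lemma zero_in_cover_monoid: "0 \<in> cover_monoid A"
  by (auto simp: cover_monoid_def covers_def intro!: exI[of _ "\<lambda>_. 0"])

lemma add_in_cover_monoid:
  assumes "u \<in> cover_monoid A" "v \<in> cover_monoid A"
  shows "u + v \<in> cover_monoid A"
proof -
  obtain y z where "covers A (lookup u) y" "total A y = lookup u (dim_row A)"
    "covers A (lookup v) z" "total A z = lookup v (dim_row A)"
    using assms by (auto simp: cover_monoid_def)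
  then have "covers A (lookup (u + v)) (\<lambda>j. y j + z j)"
      "total A (\<lambda>j. y j + z j) = lookup (u + v) (dim_row A)"
    using covers_add[of A "lookup u" y "lookup v" z] by (auto simp: covers_def lookup_add sum.distrib)
  moreover have "keys (u + v) \<subseteq> {..dim_row A}"
    using assms Poly_Mapping.keys_add[of u v] by (auto simp: cover_monoid_def)
  ultimately show ?thesis unfolding cover_monoid_def by blast
qed

text \<open>The points \<open>u + v / k\<close> lie in the cone spanned by the monoid, so the last hypothesis says that
  \<open>u\<close> lies in its closure.\<close>

lemma integer_rounding_imp_closed:
  assumes irp: "integer_rounding_property A" and u: "keys u \<subseteq> {..dim_row A}"
    and vu: "\<And>k. \<exists>w\<in>cover_monoid A. \<forall>i. lookup w i = lookup v i + k * lookup u i"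
  shows "u \<in> cover_monoid A"
proof -
  define a where "a = vec (dim_row A) (\<lambda>i. int (lookup u i))"
  have a: "a \<in> carrier_vec (dim_row A)" by (simp add: a_def)
  define F :: "real set" where "F = {total A y | y. covers A (\<lambda>i. real (lookup u i)) y}"
  have F: "covering_values (map_mat real A) (map_vec real_of_int a) = F"
  proof -
    have "covers A (($) (map_vec real_of_int a)) y \<longleftrightarrow> covers A (\<lambda>i. real (lookup u i)) y" for y
      by (auto simp: covers_def a_def)
    then show ?thesis
      using a by (simp add: covering_values_eq F_def)
  qed
  \<comment> \<open>Dividing a cover of \<open>v + k u\<close> by \<open>k\<close> gives a real
    cover of \<open>u\<close>, at an extra cost that tends to 0.\<close>
  have approx: "\<exists>y. covers A (\<lambda>i. real (lookup u i)) y
      \<and> total A y = lookup u (dim_row A) + lookup v (dim_row A) / k" if k: "k > 0" for k :: nat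
  proof -
    obtain w y where w: "\<forall>i. lookup w i = lookup v i + k * lookup u i"
      and y: "covers A (lookup w) y" "total A y = lookup w (dim_row A)"
      using vu[of k] by (auto simp: cover_monoid_def)
    have "covers A (\<lambda>i. real (lookup u i)) (\<lambda>j. real (y j) / k)"
      unfolding covers_def
    proof (intro conjI allI impI)
      fix i assume i: "i < dim_row A"
      have "k * lookup u i \<le> lookup w i" using w by simp
      also have "\<dots> \<le> (\<Sum>j<dim_col A. A $$ (i, j) * y j)"
        using y i by (simp add: covers_def)
      finally have "real (k * lookup u i) \<le> real (\<Sum>j<dim_col A. A $$ (i, j) * y j)"
        by (simp only: of_nat_le_iff)
      then show "real (lookup u i) \<le> (\<Sum>j<dim_col A. of_nat (A $$ (i, j)) * (real (y j) / k))"
        using k by (simp add: field_simps flip: sum_divide_distrib)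
    qed auto
    moreover have "total A (\<lambda>j. real (y j) / k) = lookup u (dim_row A) + lookup v (dim_row A) / k"
    proof -
      have "total A (\<lambda>j. real (y j) / k) = real (total A y) / k"
        by (simp add: sum_divide_distrib)
      then show ?thesis using k y(2) w by (simp add: field_simps)
    qed
    ultimately show ?thesis by blast
  qed
  then obtain y1 where "covers A (\<lambda>i. real (lookup u i)) y1" using approx[of 1] by auto
  then obtain m where m: "is_minimum F m"
    unfolding F_def by (rule covers_minimum)
  have m_le: "m \<le> lookup u (dim_row A)"
  proof (rule LIMSEQ_le_const)
    show "(\<lambda>k. lookup u (dim_row A) + lookup v (dim_row A) / real k)
        \<longlonglongrightarrow> real (lookup u (dim_row A))"
      using tendsto_add[OF tendsto_const lim_const_over_n[of "real (lookup v (dim_row A))"]] by simp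
    have "m \<le> lookup u (dim_row A) + lookup v (dim_row A) / k" if "k \<ge> 1" for k :: nat
      using approx[of k] that m by (auto simp: is_minimum_def F_def)
    then show "\<exists>N. \<forall>k\<ge>N. m \<le> lookup u (dim_row A) + lookup v (dim_row A) / real k"
      by blast
  qed
  \<comment> \<open>The exponent of t in \<open>u\<close> is an integer at least \<open>m\<close>,
    hence at least \<open>\<lceil>m\<rceil>\<close>, and integer rounding supplies an integral cover
    with that total.\<close>
  have "is_minimum (covering_values (map_mat int A) a) \<lceil>m\<rceil>"
    using irp m a F unfolding integer_rounding_property_def by simp
  then obtain y where y: "covers A (($) a) y" "total A y = \<lceil>m\<rceil>"
    using a by (auto simp: is_minimum_def covering_values_eq)
  define z where "z j = nat (y j)" for j
  have z: "int (z j) = y j" if "j < dim_col A" for j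
    using y(1) that by (simp add: z_def covers_def)
  have "covers A (lookup u) z"
    unfolding covers_def
  proof (intro conjI allI impI)
    fix i assume i: "i < dim_row A"
    then have "int (lookup u i) \<le> (\<Sum>j<dim_col A. int (A $$ (i, j)) * y j)"
      using y(1) by (simp add: covers_def a_def)
    also have "\<dots> = int (\<Sum>j<dim_col A. A $$ (i, j) * z j)" by (simp add: z)
    finally show "lookup u i \<le> (\<Sum>j<dim_col A. of_nat (A $$ (i, j)) * z j)"
      by (simp only: of_nat_le_iff of_nat_id)
  qed auto
  moreover have "total A z \<le> lookup u (dim_row A)"
  proof -
    have "int (total A z) = \<lceil>m\<rceil>" using y(2) by (simp add: z)
    with m_le show ?thesis by linarith
  qed
  \<comment> \<open>Without columns every monoid element has t-exponent 0, in particular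
    \<open>v + u\<close>.\<close>
  moreover have "lookup u (dim_row A) = 0" if "dim_col A = 0"
  proof -
    obtain w where "w \<in> cover_monoid A" "lookup w (dim_row A) = lookup v (dim_row A) + 1 * lookup u (dim_row A)"
      using vu[of 1] by blast
    with that show ?thesis by (auto simp: cover_monoid_def)
  qed
  ultimately obtain z' where "covers A (lookup u) z'" "total A z' = lookup u (dim_row A)"
    by (rule covers_pad)
  with u show ?thesis by (auto simp: cover_monoid_def)
qed

text \<open>A rational approximation of the optimal real cover puts some multiple
  \<open>N (a', b)\<close> with \<open>b = \<lceil>m\<rceil>\<close> into the monoid. Root closure
  removes \<open>N\<close> and leaves an integral cover with total
  \<open>\<lceil>m\<rceil>\<close>.\<close>

lemma root_closed_imp_integer_rounding:
  assumes closed: "\<And>u w N. w \<in> cover_monoid A \<Longrightarrow> N > 0 \<Longrightarrow> keys u \<subseteq> {..dim_row A} \<Longrightarrow>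
    (\<And>i. lookup w i = N * lookup u i) \<Longrightarrow> u \<in> cover_monoid A"
  shows "integer_rounding_property A"
  unfolding integer_rounding_property_def
proof (intro allI impI)
  fix a :: "int vec" and m
  assume a: "a \<in> carrier_vec (dim_row A)"
    and m: "is_minimum (covering_values (map_mat real A) (map_vec real_of_int a)) m"
  have real_vals: "covering_values (map_mat real A) (map_vec real_of_int a) =
      {total A y | y. covers A (\<lambda>i. real_of_int (a $ i)) y}"
  proof -
    have "covers A (($) (map_vec real_of_int a)) y \<longleftrightarrow> covers A (\<lambda>i. real_of_int (a $ i)) y" for y
      using a by (auto simp: covers_def)
    then show ?thesis using a by (simp add: covering_values_eq)
  qed
  obtain y where y: "covers A (\<lambda>i. real_of_int (a $ i)) y" "m = total A y"
    using m unfolding is_minimum_def real_vals by blast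
  define b where "b = nat \<lceil>m\<rceil>"
  have "m \<ge> 0" using y by (auto simp: covers_def intro!: sum_nonneg)
  then have b: "int b = \<lceil>m\<rceil>" by (simp add: b_def)
  \<comment> \<open>Exponents are natural numbers. Raising negative demands to 0 costs nothing,
    since \<open>Ay\<close> is nonnegative.\<close>
  define a' where "a' i = nat (a $ i)" for i
  have "covers A (\<lambda>i. real (a' i)) y"
    unfolding covers_def
  proof (intro conjI allI impI)
    fix i assume i: "i < dim_row A"
    have "0 \<le> (\<Sum>j<dim_col A. of_nat (A $$ (i, j)) * y j)"
      using y by (intro sum_nonneg) (auto simp: covers_def)
    with y i show "real (a' i) \<le> (\<Sum>j<dim_col A. of_nat (A $$ (i, j)) * y j)"
      by (auto simp: covers_def a'_def)
  qed (use y in \<open>auto simp: covers_def\<close>)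
  moreover have "total A y \<le> real b" using b y(2) by linarith
  ultimately obtain N z where N: "N > 0" and z: "covers A (\<lambda>i. N * a' i) z" "total A z \<le> N * b"
    by (rule covers_rational)
  have "N * b = 0" if "dim_col A = 0" using y that b by simp
  with z obtain z' where z': "covers A (\<lambda>i. N * a' i) z'" "total A z' = N * b"
    by (rule covers_pad)
  \<comment> \<open>The exponent of the monomial with x-part \<open>k a'\<close> and t-exponent
    \<open>k b\<close>, used for \<open>k = N\<close> and \<open>k = 1\<close>.\<close>
  define f where "f k i = (if i < dim_row A then k * a' i else if i = dim_row A then k * b else 0)" for k i :: nat
  have "finite {i. f k i \<noteq> 0}" for k
    by (rule finite_subset[of _ "{..dim_row A}"]) (auto simp: f_def)
  then have f: "lookup (Abs_poly_mapping (f k)) = f k" for k by simp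
  have keys: "keys (Abs_poly_mapping (f k)) \<subseteq> {..dim_row A}" for k
    by (auto simp: in_keys_iff f f_def split: if_splits)
  have "Abs_poly_mapping (f N) \<in> cover_monoid A"
    using z' keys[of N] by (auto simp: cover_monoid_def f f_def covers_def intro!: exI[of _ z'])
  then have "Abs_poly_mapping (f 1) \<in> cover_monoid A"
    by (rule closed[OF _ N keys]) (simp add: f, simp add: f_def)
  then obtain x where x: "covers A (f 1) x" "total A x = b"
    by (auto simp: cover_monoid_def f f_def)
  have "covers A (($) a) (\<lambda>j. int (x j))"
    unfolding covers_def
  proof (intro conjI allI impI)
    fix i assume i: "i < dim_row A"
    have "a $ i \<le> int (a' i)" by (simp add: a'_def)
    also have "\<dots> \<le> int (\<Sum>j<dim_col A. A $$ (i, j) * x j)"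
      using x i by (auto simp: covers_def f_def simp del: of_nat_sum)
    finally show "a $ i \<le> (\<Sum>j<dim_col A. of_nat (A $$ (i, j)) * int (x j))" by simp
  qed auto
  moreover have "\<lceil>m\<rceil> = total A (\<lambda>j. int (x j))" using b by (simp flip: x(2))
  \<comment> \<open>Integral covers are real covers, so \<open>m\<close> bounds their totals from
    below; the totals are integers, so the ceiling does too.\<close>
  moreover have "\<lceil>m\<rceil> \<le> total A w" if w: "covers A (($) a) w" for w
  proof -
    have "covers A (\<lambda>i. real_of_int (a $ i)) (\<lambda>j. real_of_int (w j))"
      unfolding covers_def
    proof (intro conjI allI impI)
      fix i assume "i < dim_row A"
      then have "a $ i \<le> (\<Sum>j<dim_col A. of_nat (A $$ (i, j)) * w j)"
        using w by (simp add: covers_def)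
      then have "real_of_int (a $ i) \<le> real_of_int (\<Sum>j<dim_col A. of_nat (A $$ (i, j)) * w j)"
        by (simp only: of_int_le_iff)
      then show "real_of_int (a $ i) \<le> (\<Sum>j<dim_col A. of_nat (A $$ (i, j)) * real_of_int (w j))"
        by simp
    qed (use w in \<open>auto simp: covers_def\<close>)
    then have "m \<le> total A (\<lambda>j. real_of_int (w j))"
      using m unfolding is_minimum_def real_vals by blast
    then have "m \<le> real_of_int (total A w)" by simp
    then show ?thesis by (simp only: ceiling_le_iff)
  qed
  ultimately show "is_minimum (covering_values (map_mat int A) a) \<lceil>m\<rceil>"
    using a by (auto simp: is_minimum_def covering_values_eq)
qed

subsection \<open>Leading exponents\<close>

text \<open>On exponent vectors the order is lexicographic, decided by the smallest index where they
  differ. For the zero polynomial the value is unspecified.\<close>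

definition lead_exp :: "('a::linorder \<Rightarrow>\<^sub>0 'b::zero) \<Rightarrow> 'a" where
  "lead_exp f = Max (keys f)"

lemma lead_exp_in_keys: "f \<noteq> 0 \<Longrightarrow> lead_exp f \<in> keys f"
  unfolding lead_exp_def by (intro Max_in) auto

lemma lead_exp_ge: "u \<in> keys f \<Longrightarrow> u \<le> lead_exp f"
  unfolding lead_exp_def by (intro Max_ge) auto

lemma lead_exp_eqI:
  assumes "u \<in> keys f" "\<And>v. v \<in> keys f \<Longrightarrow> v \<le> u"
  shows "lead_exp f = u"
  unfolding lead_exp_def using assms by (intro Max_eqI) auto

lemma lead_exp_single: "c \<noteq> 0 \<Longrightarrow> lead_exp (Poly_Mapping.single u c) = u"
  by (simp add: lead_exp_def)

text \<open>Addition is strictly monotone, so only the pair of leading exponents contributes to the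
  coefficient at their sum.\<close>

lemma lead_exp_mult:
  fixes f g :: "'a::{ordered_cancel_comm_monoid_add, linorder} \<Rightarrow>\<^sub>0 'b::semiring_no_zero_divisors"
  assumes "f \<noteq> 0" "g \<noteq> 0"
  shows "lookup (f * g) (lead_exp f + lead_exp g) = lookup f (lead_exp f) * lookup g (lead_exp g)"
    and "lead_exp (f * g) = lead_exp f + lead_exp g"
proof -
  let ?F = "lead_exp f" and ?G = "lead_exp g"
  have less: "?F + ?G \<noteq> l + r" if "l \<in> keys f" "r \<in> keys g" "l \<noteq> ?F" for l r
  proof -
    have "l < ?F" "r \<le> ?G" using that lead_exp_ge[of l f] lead_exp_ge[of r g] by auto
    then have "l + r < ?F + ?G" by (rule add_less_le_mono)
    then show ?thesis by simp
  qed
  have inner: "lookup f l * (\<Sum>r. lookup g r when ?F + ?G = l + r) =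
      (lookup f ?F * lookup g ?G when l = ?F)" for l
  proof (cases "l = ?F \<or> lookup f l = 0")
    case True
    then show ?thesis by (auto simp: when_def cong: if_cong)
  next
    case False
    then have "(lookup g r when ?F + ?G = l + r) = 0" for r
      using less[of l r] by (auto simp: when_def in_keys_iff)
    then show ?thesis using False by simp
  qed
  show *: "lookup (f * g) (?F + ?G) = lookup f ?F * lookup g ?G"
    unfolding lookup_mult inner by simp
  have "v \<le> ?F + ?G" if v: "v \<in> keys (f * g)" for v
  proof -
    obtain a b where "v = a + b" "a \<in> keys f" "b \<in> keys g"
      using v Poly_Mapping.keys_mult[of f g] by blast
    then show ?thesis by (simp add: add_mono lead_exp_ge)
  qed
  moreover have "?F + ?G \<in> keys (f * g)"
    using * assms lead_exp_in_keys[of f] lead_exp_in_keys[of g] by (simp add: in_keys_iff)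
  ultimately show "lead_exp (f * g) = ?F + ?G" by (intro lead_exp_eqI)
qed

lemma lookup_lead_exp_power:
  fixes f :: "'k::idom mpolynomial"
  assumes "f \<noteq> 0"
  shows "lookup (lead_exp (f ^ k)) i = k * lookup (lead_exp f) i"
proof (induction k)
  case 0
  show ?case by (simp add: lead_exp_def)
next
  case (Suc k)
  then show ?case using assms by (simp add: lead_exp_mult lookup_add)
qed

text \<open>The leading terms cancel and all other exponents are smaller.\<close>

lemma lead_exp_diff_less:
  fixes f g :: "'a::linorder \<Rightarrow>\<^sub>0 'b::ab_group_add"
  assumes "lead_exp f = lead_exp g" "lookup f (lead_exp f) = lookup g (lead_exp g)" "f \<noteq> g"
  shows "lead_exp (f - g) < lead_exp f"
proof -
  let ?u = "lead_exp (f - g)"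
  have u: "?u \<in> keys (f - g)" using assms by (intro lead_exp_in_keys) auto
  then have "?u \<in> keys f \<union> keys g" using Poly_Mapping.keys_diff[of f g] by blast
  then have "?u \<le> lead_exp f" using assms(1) lead_exp_ge[of _ f] lead_exp_ge[of _ g] by auto
  moreover have "?u \<noteq> lead_exp f"
    using u assms by (auto simp: in_keys_iff lookup_minus)
  ultimately show ?thesis by simp
qed

text \<open>In infinitely many variables the order is not well-founded: the variables themselves
  form a descending chain. Bounding the support of the larger element reduces it to the
  lexicographic order on lists of length \<open>n + 1\<close>.\<close>

lemma wf_less_keys_bounded: "wf {(u, v :: nat \<Rightarrow>\<^sub>0 nat). keys v \<subseteq> {..n} \<and> u < v}"
proof (rule wf_subset)
  let ?l = "\<lambda>u. map (lookup u) [0..<Suc n]"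
  show "wf (inv_image (lex less_than) ?l)" by (intro wf_inv_image wf_lex wf_less_than)
  show "{(u, v :: nat \<Rightarrow>\<^sub>0 nat). keys v \<subseteq> {..n} \<and> u < v} \<subseteq> inv_image (lex less_than) ?l"
  proof (rule subrelI)
    fix u v :: "nat \<Rightarrow>\<^sub>0 nat"
    assume "(u, v) \<in> {(u, v). keys v \<subseteq> {..n} \<and> u < v}"
    then obtain k where v: "keys v \<subseteq> {..n}" and k: "lookup u k < lookup v k"
        "\<And>k'. k' < k \<Longrightarrow> lookup u k' = lookup v k'"
      by (auto simp: less_poly_mapping.rep_eq less_fun_def)
    \<comment> \<open>The deciding index lies in the support of \<open>v\<close>, so the truncation
      to \<open>n + 1\<close> entries sees it, whatever the support of \<open>u\<close>.\<close>
    have "k \<in> keys v" using k(1) by (simp add: in_keys_iff)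
    with v have "k < Suc n" by auto
    moreover have "take k (?l u) = take k (?l v)"
      using k(2) \<open>k < Suc n\<close> by (simp add: take_map del: upt_Suc)
    moreover have "(?l u ! k, ?l v ! k) \<in> less_than"
      using k(1) \<open>k < Suc n\<close> by (simp del: upt_Suc)
    ultimately have "(?l u, ?l v) \<in> lexord less_than"
      unfolding lexord_take_index_conv by auto
    then show "(u, v) \<in> inv_image (lex less_than) ?l"
      by (simp add: lexord_lex)
  qed
qed

subsection \<open>The subalgebra as a monoid algebra\<close>

lemma generated_subalgebra_uminus:
  assumes "p \<in> generated_subalgebra G" shows "- p \<in> generated_subalgebra G"
proof -
  have "mconst (- 1) * p = - p" by (simp add: mconst_def single_uminus)
  then show ?thesis using assms generated_subalgebra.const generated_subalgebra.mult by metis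
qed

lemma generated_subalgebra_diff:
  "p \<in> generated_subalgebra G \<Longrightarrow> r \<in> generated_subalgebra G \<Longrightarrow> p - r \<in> generated_subalgebra G"
  using generated_subalgebra.add[of p G "- r"] generated_subalgebra_uminus[of r G] by simp

lemma generated_subalgebra_0: "0 \<in> generated_subalgebra G"
  using generated_subalgebra.const[of 0 G] by (simp add: mconst_def)

lemma generated_subalgebra_1: "1 \<in> generated_subalgebra G"
  using generated_subalgebra.const[of 1 G] by (simp add: mconst_def)

lemma generated_subalgebra_of_nat: "of_nat k \<in> generated_subalgebra G"
  by (induction k) (auto intro: generated_subalgebra.add generated_subalgebra_0 generated_subalgebra_1)

lemma generated_subalgebra_power:
  "p \<in> generated_subalgebra G \<Longrightarrow> p ^ k \<in> generated_subalgebra G"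
  by (induction k) (auto intro: generated_subalgebra.mult generated_subalgebra_1)

lemma generated_subalgebra_sum:
  "(\<And>i. i \<in> I \<Longrightarrow> f i \<in> generated_subalgebra G) \<Longrightarrow> sum f I \<in> generated_subalgebra G"
  by (induction I rule: infinite_finite_induct)
     (auto intro: generated_subalgebra.add generated_subalgebra_0)

section \<open>Monomial generators and their exponents\<close>

lemma mvar_power: "mvar i ^ k = Poly_Mapping.single (Poly_Mapping.single i k) 1"
  by (induction k) (auto simp: mvar_def mult_single simp flip: single_add)

lemma prod_single:
  "(\<Prod>i\<in>I. Poly_Mapping.single (f i) (1::'k::comm_ring_1)) =
   Poly_Mapping.single (\<Sum>i\<in>I. f i :: nat \<Rightarrow>\<^sub>0 nat) 1"
  by (induction I rule: infinite_finite_induct) (auto simp: mult_single)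

definition gen_exp :: "nat vec \<Rightarrow> nat \<Rightarrow>\<^sub>0 nat" where
  "gen_exp w = (\<Sum>i<dim_vec w. Poly_Mapping.single i (w $ i)) + Poly_Mapping.single (dim_vec w) 1"

lemma xmonomial_times_mvar:
  "xmonomial w * mvar (dim_vec w) = Poly_Mapping.single (gen_exp w) (1::'k::comm_ring_1)"
proof -
  have "(mvar (dim_vec w) :: 'k mpolynomial) = mvar (dim_vec w) ^ 1" by simp
  then show ?thesis
    unfolding xmonomial_def mvar_power prod_single gen_exp_def by (simp add: mvar_power mult_single)
qed

lemma lookup_gen_exp:
  "lookup (gen_exp w) i = (if i < dim_vec w then w $ i else if i = dim_vec w then 1 else 0)"
  by (auto simp: gen_exp_def lookup_add lookup_sum lookup_single when_def)

lemma gen_exp_in_cover_monoid: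
  assumes "w \<in> column_lower_set A"
  shows "gen_exp w \<in> cover_monoid A"
proof -
  obtain j where w: "dim_vec w = dim_row A" and j: "j < dim_col A" "w \<le> col A j"
    using assms by (auto simp: column_lower_set_def)
  \<comment> \<open>The unit vector selects the single column that dominates
    \<open>w\<close>.\<close>
  define y where "y j' = (if j' = j then 1 else 0 :: nat)" for j'
  have "covers A (lookup (gen_exp w)) y"
    using w j by (auto simp: covers_def lookup_gen_exp y_def less_eq_vec_def if_distrib cong: if_cong)
  moreover have "total A y = lookup (gen_exp w) (dim_row A)"
    using w j by (simp add: y_def lookup_gen_exp)
  moreover have "keys (gen_exp w) \<subseteq> {..dim_row A}"
    using w by (auto simp: in_keys_iff lookup_gen_exp split: if_splits)
  ultimately show ?thesis by (auto simp: cover_monoid_def)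
qed

text \<open>A positive t-exponent means that some column is used; one copy of it is removed together
  with the part of \<open>u\<close> that it covers.\<close>

lemma cover_monoid_split:
  assumes u: "u \<in> cover_monoid A" and pos: "lookup u (dim_row A) \<noteq> 0"
  obtains u' w where "u' \<in> cover_monoid A" "w \<in> column_lower_set A" "u = u' + gen_exp w"
proof -
  obtain y where y: "covers A (lookup u) y" "total A y = lookup u (dim_row A)"
    using u by (auto simp: cover_monoid_def)
  then obtain j where j: "j < dim_col A" "y j > 0"
    using pos by (metis gr0I lessThan_iff sum.neutral)
  \<comment> \<open>The minimum keeps \<open>w\<close> below column \<open>j\<close> and below
    \<open>u\<close>, so that subtracting it loses nothing.\<close>
  define w where "w = vec (dim_row A) (\<lambda>i. min (lookup u i) (A $$ (i, j)))"
  have [simp]: "dim_vec w = dim_row A" by (simp add: w_def)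
  have w: "w \<in> column_lower_set A"
    using j by (auto simp: column_lower_set_def w_def less_eq_vec_def)
  define u' where "u' = u - gen_exp w"
  have u': "lookup u' i = (if i < dim_row A then lookup u i - A $$ (i, j)
      else if i = dim_row A then lookup u i - 1 else lookup u i)" for i
    by (auto simp: u'_def lookup_minus lookup_gen_exp w_def)
  have "u = u' + gen_exp w"
    using pos by (intro poly_mapping_eqI) (auto simp: lookup_add u' lookup_gen_exp w_def)
  moreover define y' where "y' = y(j := y j - 1)"
  have "g j' * y j' = g j' * y' j' + (if j' = j then g j else 0)" for g :: "nat \<Rightarrow> nat" and j'
    using j(2) by (cases "y j") (auto simp: y'_def)
  then have split: "(\<Sum>j'<dim_col A. g j' * y j') = (\<Sum>j'<dim_col A. g j' * y' j') + g j" for g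
    using j(1) by (simp add: sum.distrib)
  have "covers A (lookup u') y'"
    unfolding covers_def
  proof (intro conjI allI impI)
    fix i assume i: "i < dim_row A"
    then have "lookup u i \<le> (\<Sum>j<dim_col A. A $$ (i, j) * y j)"
      using y by (simp add: covers_def)
    then show "lookup u' i \<le> (\<Sum>j<dim_col A. of_nat (A $$ (i, j)) * y' j)"
      using i unfolding split[of "\<lambda>j. A $$ (i, j)"] by (simp add: u')
  qed auto
  moreover have "total A y' = lookup u' (dim_row A)"
    using split[of "\<lambda>_. 1"] y(2) by (simp add: u')
  moreover have "keys u' \<subseteq> keys u"
    by (auto simp: in_keys_iff u' split: if_splits)
  then have "keys u' \<subseteq> {..dim_row A}" using u by (auto simp: cover_monoid_def)
  ultimately show ?thesis
    using w that[of u' w] by (auto simp: cover_monoid_def)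
qed

lemma poly_mapping_eq_sum_single: "p = (\<Sum>u\<in>keys p. Poly_Mapping.single u (lookup p u))"
  by (rule poly_mapping_eqI) (auto simp: lookup_sum lookup_single when_def in_keys_iff)

abbreviation cover_generators :: "nat mat \<Rightarrow> 'k::comm_ring_1 mpolynomial set" where
  "cover_generators A \<equiv> (\<lambda>w. xmonomial w * mvar (dim_row A)) ` column_lower_set A"

text \<open>The monoid contains the exponents of the generators and is closed under addition.
  Conversely, induction on the t-exponent splits a monoid element into exponents of
  generators.\<close>

lemma generated_subalgebra_eq:
  "generated_subalgebra (cover_generators A) =
   {p :: 'k::comm_ring_1 mpolynomial. keys p \<subseteq> cover_monoid A}" (is "?S = _")
proof (intro equalityI subsetI)
  have gen: "xmonomial w * mvar (dim_row A) = Poly_Mapping.single (gen_exp w) (1 :: 'k)"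
    if "w \<in> column_lower_set A" for w
    using that xmonomial_times_mvar[of w] by (auto simp: column_lower_set_def)
  {
    fix p :: "'k mpolynomial" assume "p \<in> ?S"
    then have "keys p \<subseteq> cover_monoid A"
    proof induction
      case (const c)
      then show ?case by (simp add: mconst_def zero_in_cover_monoid)
    next
      case (gen g)
      then show ?case
        using \<open>\<And>w. w \<in> column_lower_set A \<Longrightarrow> _\<close> gen_exp_in_cover_monoid[of _ A] by auto
    next
      case (add p p')
      then show ?case using Poly_Mapping.keys_add[of p p'] by blast
    next
      case (mult p p')
      then show ?case
        using Poly_Mapping.keys_mult[of p p'] add_in_cover_monoid[of _ A] by blast
    qed
    then show "p \<in> {p. keys p \<subseteq> cover_monoid A}" by simp
  }
  have mono: "Poly_Mapping.single u 1 \<in> ?S" if "u \<in> cover_monoid A" for u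
    using that
  proof (induction "lookup u (dim_row A)" arbitrary: u)
    case 0
    then obtain y where y: "covers A (lookup u) y" "total A y = 0" and u: "keys u \<subseteq> {..dim_row A}"
      by (auto simp: cover_monoid_def)
    \<comment> \<open>A cover with total 0 uses no column and so covers only the zero
      vector.\<close>
    have "lookup u i = 0" for i
    proof (cases i "dim_row A" rule: linorder_cases)
      case less
      then show ?thesis using y by (auto simp: covers_def)
    qed (use 0 u in \<open>auto simp: in_keys_iff\<close>)
    then have "u = 0" by (intro poly_mapping_eqI) simp
    then show ?case using generated_subalgebra_1 by simp
  next
    case (Suc b)
    then obtain u' w where u': "u' \<in> cover_monoid A" and w: "w \<in> column_lower_set A"
      and u: "u = u' + gen_exp w"
      using cover_monoid_split[of u A] by (metis nat.distinct(1))
    have "dim_vec w = dim_row A" using w by (auto simp: column_lower_set_def)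
    then have "b = lookup u' (dim_row A)"
      using Suc(2) by (simp add: u lookup_add lookup_gen_exp)
    then have "Poly_Mapping.single u' 1 \<in> ?S" using u' by (rule Suc(1))
    moreover have "Poly_Mapping.single (gen_exp w) 1 \<in> ?S"
      using w gen[OF w] by (intro generated_subalgebra.gen) force
    ultimately have "Poly_Mapping.single u' 1 * Poly_Mapping.single (gen_exp w) 1 \<in> ?S"
      by (rule generated_subalgebra.mult)
    then show ?case by (simp add: u mult_single)
  qed
  fix p :: "'k mpolynomial" assume p: "p \<in> {p. keys p \<subseteq> cover_monoid A}"
  have "Poly_Mapping.single u (lookup p u) \<in> ?S" if "u \<in> keys p" for u
  proof -
    have "mconst (lookup p u) * Poly_Mapping.single u 1 \<in> ?S"
      using that p by (intro generated_subalgebra.mult generated_subalgebra.const mono) auto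
    then show ?thesis by (simp add: mconst_def mult_single)
  qed
  then show "p \<in> ?S"
    by (subst poly_mapping_eq_sum_single) (rule generated_subalgebra_sum)
qed

subsection \<open>Integral elements\<close>

text \<open>Division by leading terms: \<open>c p^k = s^k r\<close> for all \<open>k\<close> forces the difference of the
  leading exponents of \<open>p\<close> and \<open>s\<close> into the closed cone of the monoid.\<close>

lemma almost_integral_divisible:
  fixes c s p :: "'k::field mpolynomial" and A :: "nat mat"
  defines "S \<equiv> generated_subalgebra (cover_generators A)"
  assumes irp: "integer_rounding_property A" and c: "c \<noteq> 0" and s: "s \<in> S" "s \<noteq> 0"
    and p: "p \<in> S" and almost: "\<And>k. \<exists>r\<in>S. c * p ^ k = s ^ k * r"
  shows "\<exists>r\<in>S. p = s * r"
proof -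
  have S: "S = {p. keys p \<subseteq> cover_monoid A}" unfolding S_def by (rule generated_subalgebra_eq)
  have S_add: "a + b \<in> S" and S_mult: "a * b \<in> S" and S_diff: "a - b \<in> S"
    if "a \<in> S" "b \<in> S" for a b
    using that unfolding S_def
    by (auto intro: generated_subalgebra.intros generated_subalgebra_diff)
  \<comment> \<open>The induction also needs the divisibility condition for the remainder
    \<open>p - e * s\<close>.\<close>
  define P where "P p \<longleftrightarrow> p \<in> S \<and> (\<forall>k. \<exists>r\<in>S. c * p ^ k = s ^ k * r)" for p
  have "\<exists>r\<in>S. p = s * r" if "P p" for p
    using wf_less_keys_bounded[of "dim_row A"] that
  proof (induction "lead_exp p" arbitrary: p rule: wf_induct_rule)
    case less
    show ?case
    proof (cases "p = 0")
      case True
      then show ?thesis by (intro bexI[of _ 0]) (auto simp: S)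
    next
      case False
      define u where "u = lead_exp p - lead_exp s"
      have ex: "\<exists>w\<in>cover_monoid A. \<forall>i. lookup (lead_exp c) i + k * lookup (lead_exp p) i =
          k * lookup (lead_exp s) i + lookup w i" for k
      proof -
        obtain r where r: "r \<in> S" "c * p ^ k = s ^ k * r"
          using less.prems by (auto simp: P_def)
        then have "r \<noteq> 0" using c False by auto
        then have "lead_exp r \<in> cover_monoid A"
          using r(1) lead_exp_in_keys[of r] by (auto simp: S)
        moreover have "lead_exp c + lead_exp (p ^ k) = lead_exp (s ^ k) + lead_exp r"
          using arg_cong[OF r(2), of lead_exp] c False s \<open>r \<noteq> 0\<close> by (simp add: lead_exp_mult)
        then have "lookup (lead_exp c) i + k * lookup (lead_exp p) i =
          k * lookup (lead_exp s) i + lookup (lead_exp r) i" for i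
          using False s by (metis lookup_add lookup_lead_exp_power)
        ultimately show ?thesis by blast
      qed
      have le: "lookup (lead_exp s) i \<le> lookup (lead_exp p) i" for i
      proof (rule ccontr)
        \<comment> \<open>A deficit of at least 1 at \<open>i\<close> grows to at least
          \<open>k\<close> in the \<open>k\<close>-th power, and \<open>lead_exp c\<close> cannot
          make up for it once \<open>k\<close> exceeds its entry.\<close>
        let ?k = "Suc (lookup (lead_exp c) i)"
        assume "\<not> ?thesis"
        then have "?k * lookup (lead_exp p) i + ?k \<le> ?k * lookup (lead_exp s) i"
          by (metis Suc_leI mult_Suc_right add.commute mult_le_mono2 not_le)
        moreover have "?k * lookup (lead_exp s) i \<le> lookup (lead_exp c) i + ?k * lookup (lead_exp p) i"
          using ex[of ?k] by (metis le_add1)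
        ultimately show False by linarith
      qed
      then have u: "lead_exp p = u + lead_exp s"
        by (intro poly_mapping_eqI) (simp add: u_def lookup_add lookup_minus)
      have keys_p: "keys (lead_exp p) \<subseteq> {..dim_row A}"
        using less.prems lead_exp_in_keys[OF False] by (auto simp: P_def S cover_monoid_def)
      \<comment> \<open>The offset from \<open>c\<close> is the same for all \<open>k\<close>, so
        \<open>u\<close> is in the closure of the cone.\<close>
      have "u \<in> cover_monoid A"
      proof (rule integer_rounding_imp_closed[OF irp])
        have "keys u \<subseteq> keys (lead_exp p)" by (auto simp: u in_keys_iff lookup_add)
        with keys_p show "keys u \<subseteq> {..dim_row A}" by blast
        show "\<exists>w\<in>cover_monoid A. \<forall>i. lookup w i = lookup (lead_exp c) i + k * lookup u i" for k
          using ex[of k] by (force simp: u lookup_add distrib_left)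
      qed
      \<comment> \<open>The quotient of the leading terms of \<open>p\<close> and
        \<open>s\<close>.\<close>
      define e where "e = Poly_Mapping.single u (lookup p (lead_exp p) / lookup s (lead_exp s))"
      have e: "e \<in> S" using \<open>u \<in> cover_monoid A\<close> by (simp add: S e_def)
      have lc: "lookup p (lead_exp p) \<noteq> 0" "lookup s (lead_exp s) \<noteq> 0"
        using lead_exp_in_keys[OF False] lead_exp_in_keys[OF s(2)] by (auto simp: in_keys_iff)
      then have "e \<noteq> 0" by (metis e_def lookup_single_eq lookup_zero divide_eq_0_iff)
      have lead_e: "lead_exp e = u" using lc by (simp add: e_def lead_exp_single)
      have lead: "lead_exp p = lead_exp (e * s)"
        using lead_exp_mult(2)[OF \<open>e \<noteq> 0\<close> s(2)] u lead_e by simp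
      have lead_eq: "lookup (e * s) (lead_exp p) = lookup p (lead_exp p)"
        using lead_exp_mult(1)[OF \<open>e \<noteq> 0\<close> s(2)] u lead_e lc by (simp add: e_def)
      show ?thesis
      proof (cases "p = e * s")
        case True
        then show ?thesis using e by (auto simp: mult.commute)
      next
        case p_neq: False
        then have "lead_exp (p - e * s) < lead_exp p"
          using lead lead_eq by (intro lead_exp_diff_less) auto
        moreover have "P (p - e * s)"
          unfolding P_def
        proof (intro conjI allI)
          show "p - e * s \<in> S"
            using less.prems e s by (intro S_diff S_mult) (auto simp: P_def)
          fix k
          obtain r where r: "\<And>k. r k \<in> S" "\<And>k. c * p ^ k = s ^ k * r k"
            using less.prems unfolding P_def by metis
          \<comment> \<open>In the binomial expansion of \<open>c (p - e s)^k\<close> the factor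
            \<open>c p^i\<close> equals \<open>s^i r_i\<close>, and the remaining power of
            \<open>e s\<close> supplies \<open>s^(k-i)\<close>.\<close>
          define r' where "r' = (\<Sum>i\<le>k. of_nat (k choose i) * (r i * (- e) ^ (k - i)))"
          have "r' \<in> S"
            unfolding r'_def using r(1) e unfolding S_def
            by (intro generated_subalgebra_sum generated_subalgebra.mult generated_subalgebra_of_nat
                generated_subalgebra_power generated_subalgebra_uminus) auto
          moreover have "c * (p - e * s) ^ k = s ^ k * r'"
          proof -
            have "c * (p - e * s) ^ k = c * (p + (- e) * s) ^ k" by simp
            also have "\<dots> = (\<Sum>i\<le>k. of_nat (k choose i) * ((c * p ^ i) * ((- e) * s) ^ (k - i)))"
              unfolding binomial_ring sum_distrib_left by (simp add: mult_ac)
            also have "\<dots> = (\<Sum>i\<le>k. s ^ k * (of_nat (k choose i) * (r i * (- e) ^ (k - i))))"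
            proof (rule sum.cong)
              fix i assume "i \<in> {..k}"
              then have "s ^ k = s ^ i * s ^ (k - i)" by (simp flip: power_add)
              then show "of_nat (k choose i) * ((c * p ^ i) * ((- e) * s) ^ (k - i)) =
                  s ^ k * (of_nat (k choose i) * (r i * (- e) ^ (k - i)))"
                unfolding r(2) power_mult_distrib by (simp add: mult_ac)
            qed simp
            also have "\<dots> = s ^ k * r'" by (simp add: r'_def sum_distrib_left)
            finally show ?thesis .
          qed
          ultimately show "\<exists>r\<in>S. c * (p - e * s) ^ k = s ^ k * r" by blast
        qed
        ultimately obtain r where "r \<in> S" "p - e * s = s * r"
          using less.hyps[of "p - e * s"] keys_p by auto
        then have "p = s * (r + e)" by (simp add: algebra_simps)
        then show ?thesis using S_add[OF \<open>r \<in> S\<close> e] by blast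
      qed
    qed
  qed
  then show ?thesis using p almost by (simp add: P_def)
qed

section \<open>Integral elements have a common denominator for all powers\<close>

lemma to_fract_power: "to_fract (x ^ k) = to_fract x ^ k"
  by (induction k) auto

text \<open>A monic equation of degree \<open>d\<close> reduces every power of
  \<open>z = p / s\<close> to powers below \<open>d\<close>, so \<open>s^d\<close> clears all
  denominators.\<close>

lemma integral_imp_almost_integral:
  fixes p s :: "'k::field mpolynomial" and G :: "'k mpolynomial set"
  defines "S \<equiv> generated_subalgebra G"
  assumes p: "p \<in> S" and s: "s \<in> S" "s \<noteq> 0" and int: "integral_over S (Fract p s)"
  obtains d where "\<And>k. \<exists>r\<in>S. s ^ d * p ^ k = s ^ k * r"
proof -
  define z where "z = Fract p s"
  define T where "T = to_fract ` S"
  obtain f where f: "lead_coeff f = 1" "\<And>i. coeff f i \<in> T" "poly f z = 0"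
    using int by (auto simp: integral_over_def z_def T_def)
  have T_mult: "a * b \<in> T" if "a \<in> T" "b \<in> T" for a b
    using that unfolding T_def S_def
    by (auto intro: generated_subalgebra.mult simp flip: to_fract_mult)
  have T_uminus: "- a \<in> T" if "a \<in> T" for a
    using that unfolding T_def S_def
    by (auto intro: generated_subalgebra_uminus simp flip: to_fract_uminus)
  have T_sum: "sum g I \<in> T" if "\<And>i. i \<in> I \<Longrightarrow> g i \<in> T" for g and I :: "nat set"
    using that
  proof (induction I rule: infinite_finite_induct)
    case (insert i I)
    then have "g i \<in> T" "sum g I \<in> T" by auto
    then show ?case using insert.hyps unfolding T_def S_def
      by (auto intro: generated_subalgebra.add simp flip: to_fract_add)
  qed (auto simp: T_def S_def image_iff intro!: bexI[of _ 0] generated_subalgebra_0)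
  define d where "d = Polynomial.degree f"
  have sz: "to_fract s * z = to_fract p"
    using s by (simp add: z_def to_fract_def eq_fract)
  have zd: "z ^ d = - (\<Sum>i<d. coeff f i * z ^ i)"
  proof -
    have "0 = (\<Sum>i\<le>d. coeff f i * z ^ i)" using f(3) by (simp add: poly_altdef d_def)
    also have "\<dots> = (\<Sum>i<d. coeff f i * z ^ i) + z ^ d"
      using f(1) by (simp add: d_def flip: lessThan_Suc_atMost)
    finally show ?thesis by (simp add: eq_neg_iff_add_eq_0 add.commute)
  qed
  have almost: "to_fract (s ^ d) * z ^ k \<in> T" for k
  proof (induction k rule: less_induct)
    case (less k)
    show ?case
    proof (cases "k < d")
      case True
      then have "s ^ d = s ^ (d - k) * s ^ k" by (simp flip: power_add)
      then have "to_fract (s ^ d) * z ^ k = to_fract (s ^ (d - k)) * (to_fract s * z) ^ k"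
        by (simp add: to_fract_mult to_fract_power power_mult_distrib)
      also have "\<dots> = to_fract (s ^ (d - k) * p ^ k)"
        by (simp add: sz to_fract_mult to_fract_power)
      finally have "to_fract (s ^ d) * z ^ k = to_fract (s ^ (d - k) * p ^ k)" .
      moreover have "s ^ (d - k) * p ^ k \<in> S"
        using p s unfolding S_def
        by (intro generated_subalgebra.mult generated_subalgebra_power)
      ultimately show ?thesis unfolding T_def by (rule image_eqI)
    next
      case False
      then have "z ^ k = z ^ (k - d) * z ^ d" by (simp flip: power_add)
      \<comment> \<open>All exponents \<open>i + (k - d)\<close> are below \<open>k\<close>, so the
        induction hypothesis applies to each summand.\<close>
      then have "to_fract (s ^ d) * z ^ k =
          - (\<Sum>i<d. coeff f i * (to_fract (s ^ d) * z ^ (i + (k - d))))"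
        by (simp add: zd sum_distrib_left power_add mult_ac)
      also have "\<dots> \<in> T"
        using False by (intro T_uminus T_sum T_mult f(2) less) auto
      finally show ?thesis .
    qed
  qed
  have "\<exists>r\<in>S. s ^ d * p ^ k = s ^ k * r" for k
  proof -
    obtain r where r: "r \<in> S" "to_fract (s ^ d) * z ^ k = to_fract r"
      using almost[of k] by (auto simp: T_def)
    have "to_fract (s ^ d * p ^ k) = to_fract (s ^ d) * (to_fract s * z) ^ k"
      by (simp add: sz to_fract_mult to_fract_power)
    also have "\<dots> = to_fract (s ^ k) * (to_fract (s ^ d) * z ^ k)"
      by (simp add: to_fract_power power_mult_distrib mult_ac)
    also have "\<dots> = to_fract (s ^ k * r)" by (simp add: r(2))
    finally have "s ^ d * p ^ k = s ^ k * r" by (simp only: to_fract_eq_iff)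
    with r(1) show ?thesis by blast
  qed
  then show ?thesis by (rule that)
qed

section \<open>Powers of monomials and the equivalence\<close>

lemma lookup_single_power:
  "\<exists>v. Poly_Mapping.single u (1 :: 'k::comm_ring_1) ^ k = Poly_Mapping.single v 1 \<and>
     (\<forall>i. lookup v i = k * lookup (u :: nat \<Rightarrow>\<^sub>0 nat) i)"
proof (induction k)
  case 0
  show ?case by (intro exI[of _ 0]) simp
next
  case (Suc k)
  then obtain v where "Poly_Mapping.single u (1 :: 'k) ^ k = Poly_Mapping.single v 1"
    "\<forall>i. lookup v i = k * lookup u i" by blast
  then show ?case by (intro exI[of _ "u + v"]) (simp add: mult_single lookup_add)
qed

theorem theorem1p2p5:
  fixes A :: "nat mat" and n q :: nat
  assumes "A \<in> carrier_mat n q"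
    and "\<forall>i<n. row A i \<noteq> 0\<^sub>v q"
    and "\<forall>j<q. col A j \<noteq> 0\<^sub>v n"
  shows "integer_rounding_property A \<longleftrightarrow>
    normal_subring (generated_subalgebra
      ((\<lambda>w. xmonomial w * mvar n) ` column_lower_set A :: 'k::field mpolynomial set))"
proof -
  have n: "n = dim_row A" using assms(1) by simp
  define S :: "'k mpolynomial set" where "S = generated_subalgebra (cover_generators A)"
  have S: "S = {p. keys p \<subseteq> cover_monoid A}" unfolding S_def by (rule generated_subalgebra_eq)
  have "integer_rounding_property A \<longleftrightarrow> normal_subring S"
  proof
    assume irp: "integer_rounding_property A"
    show "normal_subring S"
      unfolding normal_subring_def
    proof (intro ballI impI)
      fix z assume "z \<in> fraction_field_of S" and int: "integral_over S z"
      then obtain p s where z: "z = Fract p s" and ps: "p \<in> S" "s \<in> S" "s \<noteq> 0"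
        by (auto simp: fraction_field_of_def)
      obtain d where "\<And>k. \<exists>r\<in>S. s ^ d * p ^ k = s ^ k * r"
        using integral_imp_almost_integral[of p "cover_generators A" s] ps int
        unfolding S_def z by blast
      then obtain r where "r \<in> S" "p = s * r"
        using almost_integral_divisible[OF irp, of "s ^ d" s p] ps unfolding S_def by auto
      then have "z = to_fract r" using ps by (simp add: z to_fract_def eq_fract mult.commute)
      with \<open>r \<in> S\<close> show "z \<in> to_fract ` S" by blast
    qed
  next
    assume normal: "normal_subring S"
    show "integer_rounding_property A"
    proof (rule root_closed_imp_integer_rounding)
      fix u w :: "nat \<Rightarrow>\<^sub>0 nat" and N :: nat
      assume w: "w \<in> cover_monoid A" and N: "N > 0" and u: "keys u \<subseteq> {..dim_row A}"
        and wu: "\<And>i. lookup w i = N * lookup u i"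
      \<comment> \<open>Multiplying the monomial with exponent \<open>u\<close> by
        \<open>t^b\<close> raises its t-exponent to that of \<open>w\<close>. The cover of
        \<open>w\<close> then serves for it, and the monomial becomes a fraction with denominator
        \<open>t^b\<close>.\<close>
      define b where "b = (N - 1) * lookup u (dim_row A)"
      obtain y where y: "covers A (lookup w) y" "total A y = lookup w (dim_row A)"
        using w by (auto simp: cover_monoid_def)
      define e :: "'k mpolynomial" where "e = Poly_Mapping.single u 1"
      define t where "t = Poly_Mapping.single (dim_row A) b"
      have Nb: "N * lookup u (dim_row A) = lookup u (dim_row A) + b"
        using N by (cases N) (auto simp: b_def)
      have t_lookup: "lookup t i = (if i = dim_row A then b else 0)" for i
        by (auto simp: t_def lookup_single when_def)
      have "b = 0" if "dim_col A = 0" using y(2) that Nb by (simp add: wu)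
      then obtain x where x: "total A x = b"
        using covers_pad[of A "\<lambda>_. 0" "\<lambda>_. 0" b] by (auto simp: covers_def)
      \<comment> \<open>\<open>t^b\<close> has no x-part, so any multiplicities with total
        \<open>b\<close> will do.\<close>
      have "covers A (lookup t) x" by (auto simp: covers_def t_lookup)
      moreover have "keys t \<subseteq> {..dim_row A}" by (simp add: t_def)
      ultimately have t: "t \<in> cover_monoid A"
        using x by (auto simp: cover_monoid_def t_lookup)
      have "u + t \<in> cover_monoid A"
      proof -
        have "covers A (lookup (u + t)) y"
          using y(1) by (rule covers_mono) (use N in \<open>auto simp: lookup_add t_lookup wu\<close>)
        moreover have "total A y = lookup (u + t) (dim_row A)"
          using y(2) Nb by (simp add: lookup_add t_lookup wu)
        moreover have "keys (u + t) \<subseteq> {..dim_row A}"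
          using u t Poly_Mapping.keys_add[of u t] by (auto simp: cover_monoid_def)
        ultimately show ?thesis by (auto simp: cover_monoid_def)
      qed
      with t have "e * Poly_Mapping.single t 1 \<in> S" "Poly_Mapping.single t 1 \<in> S"
        by (auto simp: S e_def mult_single)
      moreover have t_nz: "Poly_Mapping.single t (1 :: 'k) \<noteq> 0"
        by (metis lookup_single_eq lookup_zero zero_neq_one)
      moreover have "to_fract e = Fract (e * Poly_Mapping.single t 1) (Poly_Mapping.single t 1)"
        using t_nz by (simp add: to_fract_def eq_fract)
      ultimately have "to_fract e \<in> fraction_field_of S"
        unfolding fraction_field_of_def by blast
      moreover have "integral_over S (to_fract e)"
      proof -
        obtain v where v: "e ^ N = Poly_Mapping.single v 1" "\<forall>i. lookup v i = N * lookup u i"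
          unfolding e_def using lookup_single_power by blast
        have "v = w" using v(2) wu by (intro poly_mapping_eqI) simp
        with v(1) w have eN: "e ^ N \<in> S" by (simp add: S)
        \<comment> \<open>The monic polynomial \<open>X^N - e^N\<close> has the root
          \<open>e\<close>, and \<open>e^N\<close> is the monomial with exponent
          \<open>w\<close>.\<close>
        define f where "f = monom 1 N - [:to_fract (e ^ N):]"
        have coeff_f: "coeff f i = to_fract (if i = N then 1 else if i = 0 then - (e ^ N) else 0)" for i
          using N by (auto simp: f_def coeff_pCons split: nat.split)
        have "Polynomial.degree f = N"
        proof (rule antisym)
          show "Polynomial.degree f \<le> N" by (rule degree_le) (use N in \<open>auto simp: coeff_f\<close>)
          show "N \<le> Polynomial.degree f" by (rule le_degree) (simp add: coeff_f)
        qed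
        then have "lead_coeff f = 1" by (simp add: coeff_f)
        moreover have "coeff f i \<in> to_fract ` S" for i
          using eN zero_in_cover_monoid[of A] unfolding coeff_f by (intro imageI) (auto simp: S)
        moreover have "poly f (to_fract e) = 0"
          by (simp add: f_def poly_monom to_fract_power)
        ultimately show ?thesis unfolding integral_over_def by blast
      qed
      ultimately have "to_fract e \<in> to_fract ` S"
        using normal by (auto simp: normal_subring_def)
      then have "e \<in> S" by auto
      then show "u \<in> cover_monoid A" by (simp add: S e_def)
    qed
  qed
  then show ?thesis by (simp add: S_def n)
qed

end
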